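(* Let $\boldsymbol{u}=(u_1,\dots,u_n)$ be a weakly increasing vector of positive integers and fix a lucky set $I\subseteq[n]$ of $\mathrm{PF}(\boldsymbol{u})$. Then $$|\mathsf{LuckyPF}_{\boldsymbol{u}}(I)|=\sum_{B\in\mathcal{O}_{\boldsymbol{u}}(I)}\left(\prod_{b\in[n]\setminus I}s_B(b)\right).$$
   Context: Notation: $[n]=\{1,\dots,n\}$, $\mathbb{N}=\{1,2,\dots\}$. For a weakly increasing vector $\boldsymbol{u}=(u_1,\dots,u_n)$ of positive integers, spot $i\in\mathbb{N}$ on a one-way street has capacity $m_i(\boldsymbol{u})$, the number of times $i$ occurs in $\boldsymbol{u}$. Cars $1,\dots,n$ enter in this order with preferences $\boldsymbol{a}=(a_1,\dots,a_n)\in\mathbb{N}^n$; car $c$ parks in the first spot $j\ge a_c$ in which fewer than $m_j(\boldsymbol{u})$ cars are already parked, and fails to park if there is none. $\boldsymbol{a}$ is a $\boldsymbol{u}$-parking function if all cars park; $\mathrm{PF}(\boldsymbol{u})$ is the set of these. The outcome of $\boldsymbol{a}\in\mathrm{PF}(\boldsymbol{u})$ is $\mathcal{O}_{\boldsymbol{u}}(\boldsymbol{a})=B_1B_2\cdots B_M$ with $M=\max(\boldsymbol{u})$, where $B_i$ is the set of cars parked in spot $i$ if $m_i(\boldsymbol{u})>0$, and $B_i=\mathtt{X}$ if $m_i(\boldsymbol{u})=0$. A car is lucky if it parks in its preferred spot; $\mathsf{Lucky}_{\boldsymbol{u}}(\boldsymbol{a})$ is the set of lucky cars. A set $I\subseteq[n]$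 is a lucky set of $\mathrm{PF}(\boldsymbol{u})$ if $I=\mathsf{Lucky}_{\boldsymbol{u}}(\boldsymbol{a})$ for some $\boldsymbol{a}\in\mathrm{PF}(\boldsymbol{u})$. $\mathsf{LuckyPF}_{\boldsymbol{u}}(I)=\{\boldsymbol{a}\in\mathrm{PF}(\boldsymbol{u}):\mathsf{Lucky}_{\boldsymbol{u}}(\boldsymbol{a})=I\}$ and $\mathcal{O}_{\boldsymbol{u}}(I)=\{\mathcal{O}_{\boldsymbol{u}}(\boldsymbol{a}):\boldsymbol{a}\in\mathsf{LuckyPF}_{\boldsymbol{u}}(I)\}$. For an outcome $B=B_1\cdots B_M$, let $b_i=\max(B_i)$ if $B_i\ne\mathtt{X}$ and $b_i=\mathtt{X}$ otherwise, with the convention $\mathtt{X}<c$ for every $c\in\mathbb{N}$. For $b\in B_i$, $s_B(b)$ is the length of the longest contiguous sequence $b_jb_{j+1}\cdots b_{i-1}$ (ending at index $i-1$) with $b_t<b$ for all $j\le t\le i-1$; it is $0$ if no nonempty such sequence exists. *)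

theory Defs
  imports Main "HOL-Library.Option_ord"
begin

text \<open>
  Vectors are lists. Cars, spots and vector positions are numbered from 1 while list
  positions start at 0, so the preference of car \<open>c\<close> is \<open>a ! (c - 1)\<close>.
\<close>

definition capacity :: "nat list \<Rightarrow> nat \<Rightarrow> nat" where
  "capacity u i = count_list u i"

text \<open>
  The state is the list of spots taken by the cars that have entered so far, in order of
  entry; \<open>None\<close> records a car that failed to park.
\<close>

definition available :: "nat list \<Rightarrow> nat option list \<Rightarrow> nat \<Rightarrow> nat \<Rightarrow> bool" where
  "available u ps p j \<longleftrightarrow> p \<le> j \<and> count_list ps (Some j) < capacity u j"

definition park_step :: "nat list \<Rightarrow> nat option list \<Rightarrow> nat \<Rightarrow> nat option list" where
  "park_step u ps p =
     ps @ [if \<exists>j. available u ps p j then Some (LEAST j. available u ps p j) else None]"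

definition park :: "nat list \<Rightarrow> nat list \<Rightarrow> nat option list" where
  "park u a = foldl (park_step u) [] a"

definition parks_in :: "nat list \<Rightarrow> nat list \<Rightarrow> nat \<Rightarrow> nat option" where
  "parks_in u a c = park u a ! (c - 1)"

definition PF :: "nat list \<Rightarrow> nat list set" where
  "PF u = {a. length a = length u \<and> (\<forall>p\<in>set a. 0 < p) \<and>
              (\<forall>c\<in>{1..length u}. parks_in u a c \<noteq> None)}"

text \<open>In an outcome, \<open>None\<close> stands for the symbol \<open>X\<close>.\<close>

definition outcome :: "nat list \<Rightarrow> nat list \<Rightarrow> nat set option list" where
  "outcome u a =
     map (\<lambda>i. if 0 < capacity u i then Some {c \<in> {1..length u}. parks_in u a c = Some i}
              else None)
         [1..<Suc (Max (set u))]"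

definition Lucky :: "nat list \<Rightarrow> nat list \<Rightarrow> nat set" where
  "Lucky u a = {c \<in> {1..length u}. parks_in u a c = Some (a ! (c - 1))}"

definition lucky_set :: "nat list \<Rightarrow> nat set \<Rightarrow> bool" where
  "lucky_set u I \<longleftrightarrow> I \<subseteq> {1..length u} \<and> (\<exists>a\<in>PF u. I = Lucky u a)"

definition LuckyPF :: "nat list \<Rightarrow> nat set \<Rightarrow> nat list set" where
  "LuckyPF u I = {a \<in> PF u. Lucky u a = I}"

definition outcomes :: "nat list \<Rightarrow> nat set \<Rightarrow> nat set option list set" where
  "outcomes u I = outcome u ` LuckyPF u I"

definition block_max :: "nat set option list \<Rightarrow> nat \<Rightarrow> nat option" where
  "block_max B i = map_option Max (B ! (i - 1))"

definition block_index :: "nat set option list \<Rightarrow> nat \<Rightarrow> nat" where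
  "block_index B b = (THE i. i \<in> {1..length B} \<and> (\<exists>C. B ! (i - 1) = Some C \<and> b \<in> C))"

text \<open>
  The order on options makes \<open>None\<close> the least element, which is the convention
  \<open>X < c\<close>. The choice \<open>j = i\<close> is the empty sequence, of length 0.
\<close>

definition s :: "nat set option list \<Rightarrow> nat \<Rightarrow> nat" where
  "s B b = (let i = block_index B b in
     Max {i - j | j. 1 \<le> j \<and> j \<le> i \<and> (\<forall>t\<in>{j..<i}. block_max B t < Some b)})"

end

theory Submission
  imports Defs "HOL-Library.Multiset"
begin

text \<open>
  Fix an outcome and count the preference vectors that produce it. The capacities of a vector
  \<open>u\<close> of length \<open>n\<close> add up to \<open>n\<close>, so when all \<open>n\<close> cars park, every spot ends up full
  (\<open>count_list_spots_eq_capacity\<close>). Hence spot \<open>t\<close> is already full when car \<open>c\<close> enters exactly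
  if no car from \<open>c\<close> on parks there, that is, if the largest car of its block is smaller than
  \<open>c\<close>, or the spot is an \<open>X\<close> (\<open>full_iff_block_max_less\<close>).

  The outcome determines the spot of each car and therefore the state of the street that each
  car meets. So the cars may choose their preferences independently of each other: the vectors
  with the given outcome and lucky set form a product of finite sets, one for each car
  (\<open>fiber_eq\<close>). A car
  that parks in spot \<open>i\<close> can prefer \<open>i\<close> itself, in which case it is lucky, or some \<open>p < i\<close> such
  that all of \<open>p, \<dots>, i - 1\<close> are full when it enters. By the description of full spots, the
  number of the latter is the length of the longest run of smaller block maxima that ends at
  \<open>i - 1\<close> (\<open>card_choices\<close>). Thus a lucky car contributes the factor 1 and an unlucky car \<open>b\<close> the
  factor \<open>s B b\<close>, and summing over the outcomes gives the theorem.
\<close>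

section \<open>Parking as a sequence of independent choices\<close>

definition first_spot :: "nat list \<Rightarrow> nat option list \<Rightarrow> nat \<Rightarrow> nat option" where
  "first_spot u ps p =
     (if \<exists>j. available u ps p j then Some (LEAST j. available u ps p j) else None)"

lemma first_spot_eq_Some_iff:
  "first_spot u ps p = Some i \<longleftrightarrow>
     p \<le> i \<and> count_list ps (Some i) < capacity u i \<and>
     (\<forall>t\<in>{p..<i}. capacity u t \<le> count_list ps (Some t))"
proof -
  have "first_spot u ps p = Some i \<longleftrightarrow>
      available u ps p i \<and> (\<forall>t<i. \<not> available u ps p t)"
  proof
    assume "first_spot u ps p = Some i"
    then show "available u ps p i \<and> (\<forall>t<i. \<not> available u ps p t)"
      unfolding first_spot_def by (auto split: if_splits intro: LeastI dest: not_less_Least)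
  next
    assume *: "available u ps p i \<and> (\<forall>t<i. \<not> available u ps p t)"
    then have "(LEAST j. available u ps p j) = i"
      by (intro Least_equality) (auto simp: not_less[symmetric])
    with * show "first_spot u ps p = Some i"
      unfolding first_spot_def by auto
  qed
  then show ?thesis
    by (auto simp: available_def not_less)
qed

lemma park_Nil [simp]: "park u [] = []"
  by (simp add: park_def)

lemma park_snoc [simp]: "park u (a @ [p]) = park u a @ [first_spot u (park u a) p]"
  by (simp add: park_def park_step_def first_spot_def)

lemma length_park [simp]: "length (park u a) = length a"
  by (induction a rule: rev_induct) auto

text \<open>
  The state that a car meets is a prefix of the final state. Once the final state is prescribed,
  each preference is therefore subject to a condition of its own, which does not involve the
  other preferences.
\<close>

lemma park_eq_iff:
  "park u a = ps \<longleftrightarrow>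
     length a = length ps \<and> (\<forall>k<length ps. first_spot u (take k ps) (a ! k) = ps ! k)"
proof (induction a arbitrary: ps rule: rev_induct)
  case Nil
  then show ?case by auto
next
  case (snoc p a)
  show ?case
  proof (cases ps rule: rev_cases)
    case Nil
    then show ?thesis by simp
  next
    case (snoc qs q)
    have "park u (a @ [p]) = ps \<longleftrightarrow> park u a = qs \<and> first_spot u qs p = q"
      by (auto simp: snoc)
    also have "\<dots> \<longleftrightarrow> length a = length qs \<and>
        (\<forall>k<length qs. first_spot u (take k qs) (a ! k) = qs ! k) \<and> first_spot u qs p = q"
      using snoc.IH[of qs] by auto
    also have "\<dots> \<longleftrightarrow> length (a @ [p]) = length ps \<and>
        (\<forall>k<length ps. first_spot u (take k ps) ((a @ [p]) ! k) = ps ! k)"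
      by (auto simp: snoc nth_append less_Suc_eq)
    finally show ?thesis .
  qed
qed

lemma count_list_park_le: "count_list (park u a) (Some t) \<le> capacity u t"
proof (induction a rule: rev_induct)
  case (snoc p a)
  then show ?case
    using first_spot_eq_Some_iff[of u "park u a" p t] by auto
qed simp

text \<open>
  When all cars park, their spots are best recorded as a list of numbers without \<open>None\<close>.
\<close>

lemma mem_PF_iff:
  "a \<in> PF u \<longleftrightarrow>
     length a = length u \<and> (\<forall>p\<in>set a. 0 < p) \<and> (\<exists>q. park u a = map Some q)"
proof -
  have "(\<forall>c\<in>{1..length u}. parks_in u a c \<noteq> None) \<longleftrightarrow> (\<exists>q. park u a = map Some q)"
    if len: "length a = length u"
  proof -
    have "(\<forall>c\<in>{1..length u}. parks_in u a c \<noteq> None) \<longleftrightarrow>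
        (\<forall>k<length u. park u a ! k \<noteq> None)"
      unfolding parks_in_def
      by (metis Suc_le_eq Suc_pred atLeastAtMost_iff diff_Suc_1 le_add1 plus_1_eq_Suc
          less_eq_Suc_le One_nat_def)
    also have "\<dots> \<longleftrightarrow> (\<forall>x\<in>set (park u a). x \<noteq> None)"
      using len by (simp add: all_set_conv_all_nth)
    also have "\<dots> \<longleftrightarrow> (\<exists>q. park u a = map Some q)"
    proof
      assume "\<forall>x\<in>set (park u a). x \<noteq> None"
      then have "park u a = map Some (map the (park u a))"
        by (simp add: map_idI)
      then show "\<exists>q. park u a = map Some q" by blast
    qed auto
    finally show ?thesis .
  qed
  then show ?thesis
    unfolding PF_def by blast
qed

section \<open>Full spots and block maxima\<close>

lemma count_list_map_Some [simp]: "count_list (map Some xs) (Some x) = count_list xs x"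
  by (induction xs) auto

text \<open>
  No spot receives more cars than its capacity, and the number of cars equals the sum of the
  capacities, so no capacity remains unused.
\<close>

lemma count_list_spots_eq_capacity:
  assumes "length a = length u" and "park u a = map Some q"
  shows "count_list q t = capacity u t"
proof -
  have len: "length q = length u"
    using assms by (metis length_map length_park)
  have "count_list q x \<le> count_list u x" for x
    using count_list_park_le[of u a x] assms by (simp add: capacity_def)
  then have "mset q \<subseteq># mset u"
    by (intro mset_subset_eqI) (simp add: count_mset)
  with len have "mset q = mset u"
    by (metis mset_subset_size less_irrefl size_mset subset_mset.le_imp_less_or_eq)
  then show ?thesis
    by (metis count_mset capacity_def)
qed

lemma count_list_take_ge_iff:
  "count_list xs x \<le> count_list (take k xs) x \<longleftrightarrow> (\<forall>m<length xs. xs ! m = x \<longrightarrow> m < k)"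
proof -
  have "count_list xs x = count_list (take k xs) x + count_list (drop k xs) x"
    by (metis append_take_drop_id count_list_append)
  then have "count_list xs x \<le> count_list (take k xs) x \<longleftrightarrow> x \<notin> set (drop k xs)"
    by (simp add: count_list_0_iff)
  also have "\<dots> \<longleftrightarrow> (\<forall>m<length xs. xs ! m = x \<longrightarrow> m < k)"
  proof
    assume *: "x \<notin> set (drop k xs)"
    show "\<forall>m<length xs. xs ! m = x \<longrightarrow> m < k"
    proof (intro allI impI, rule ccontr)
      fix m assume m: "m < length xs" "xs ! m = x" "\<not> m < k"
      then have "drop k xs ! (m - k) = x" "m - k < length (drop k xs)"
        by auto
      with * show False
        by (metis nth_mem)
    qed
  next
    assume *: "\<forall>m<length xs. xs ! m = x \<longrightarrow> m < k"
    show "x \<notin> set (drop k xs)"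
    proof
      assume "x \<in> set (drop k xs)"
      then obtain m where "m < length (drop k xs)" "drop k xs ! m = x"
        by (auto simp only: in_set_conv_nth)
      then have "k + m < length xs" "xs ! (k + m) = x"
        by auto
      with * show False
        by fastforce
    qed
  qed
  finally show ?thesis .
qed

lemma parks_in_Suc:
  assumes "park u a = map Some q" and "k < length q"
  shows "parks_in u a (Suc k) = Some (q ! k)"
  using assms by (simp add: parks_in_def)

lemma spot_bounds:
  assumes "\<forall>x\<in>set u. 0 < x" and "length a = length u" and "park u a = map Some q"
    and "k < length u"
  shows "1 \<le> q ! k" and "q ! k \<le> Max (set u)" and "0 < capacity u (q ! k)"
proof -
  have "length q = length u"
    using assms by (metis length_map length_park)
  then have "count_list q (q ! k) \<noteq> 0"
    using assms(4) by (simp add: count_list_0_iff)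
  then show cap: "0 < capacity u (q ! k)"
    using count_list_spots_eq_capacity[OF assms(2,3)] by simp
  then have "q ! k \<in> set u"
    by (metis capacity_def count_list_0_iff less_irrefl)
  then show "1 \<le> q ! k" and "q ! k \<le> Max (set u)"
    using assms(1) by (auto simp: Suc_le_eq)
qed

lemma outcome_nth:
  assumes "1 \<le> i" and "i \<le> Max (set u)"
  shows "outcome u a ! (i - 1) =
    (if 0 < capacity u i then Some {c \<in> {1..length u}. parks_in u a c = Some i} else None)"
proof -
  have "[1..<Suc (Max (set u))] ! (i - 1) = i" "i - 1 < length [1..<Suc (Max (set u))]"
    using assms by (auto simp del: upt_Suc)
  then show ?thesis
    unfolding outcome_def by (simp del: upt_Suc)
qed

lemma mem_block_iff:
  assumes "park u a = map Some q" and "length q = length u"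
  shows "c \<in> {c \<in> {1..length u}. parks_in u a c = Some i} \<longleftrightarrow>
    (\<exists>k<length u. c = Suc k \<and> q ! k = i)"
  using assms parks_in_Suc[OF assms(1)]
  by (cases c) auto

text \<open>
  The left-hand side says that spot \<open>t\<close> is full when car \<open>Suc k\<close> enters. As spot \<open>t\<close> is full in
  the end, this means that it receives none of the cars from \<open>Suc k\<close> on.
\<close>

lemma full_iff_block_max_less:
  assumes "length a = length u" and q: "park u a = map Some q"
    and t: "1 \<le> t" "t \<le> Max (set u)"
  shows "capacity u t \<le> count_list (take k q) t \<longleftrightarrow> block_max (outcome u a) t < Some (Suc k)"
proof -
  have len: "length q = length u"
    using assms by (metis length_map length_park)
  have cap: "count_list q t = capacity u t"
    by (rule count_list_spots_eq_capacity[OF assms(1,2)])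
  show ?thesis
  proof (cases "0 < capacity u t")
    case False
    then show ?thesis
      using outcome_nth[OF t, of a] by (simp add: block_max_def)
  next
    case True
    let ?C = "{c \<in> {1..length u}. parks_in u a c = Some t}"
    have "t \<in> set q"
      using True cap by (metis count_list_0_iff less_irrefl)
    then obtain m where "m < length u" "q ! m = t"
      using len by (auto simp: in_set_conv_nth)
    then have "?C \<noteq> {}"
      using mem_block_iff[OF q len, of "Suc m" t] by blast
    then have "block_max (outcome u a) t < Some (Suc k) \<longleftrightarrow> (\<forall>c\<in>?C. c < Suc k)"
      using outcome_nth[OF t, of a] True by (simp add: block_max_def)
    also have "\<dots> \<longleftrightarrow> (\<forall>m<length q. q ! m = t \<longrightarrow> m < k)"
      unfolding Ball_def mem_block_iff[OF q len] using len by auto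
    also have "\<dots> \<longleftrightarrow> capacity u t \<le> count_list (take k q) t"
      by (simp only: cap[symmetric] count_list_take_ge_iff)
    finally show ?thesis by simp
  qed
qed

lemma block_index_outcome:
  assumes "\<forall>x\<in>set u. 0 < x" and "length a = length u" and q: "park u a = map Some q"
    and k: "k < length u"
  shows "block_index (outcome u a) (Suc k) = q ! k"
proof -
  have len: "length q = length u"
    using assms by (metis length_map length_park)
  have lenB: "length (outcome u a) = Max (set u)"
    by (simp add: outcome_def del: upt_Suc)
  show ?thesis
    unfolding block_index_def
  proof (rule the_equality)
    show "q ! k \<in> {1..length (outcome u a)} \<and>
        (\<exists>C. outcome u a ! (q ! k - 1) = Some C \<and> Suc k \<in> C)"
      using spot_bounds[OF assms] outcome_nth[of "q ! k" u a] k
        mem_block_iff[OF q len, of "Suc k" "q ! k"]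
      by (simp add: lenB)
  next
    fix i assume i: "i \<in> {1..length (outcome u a)} \<and>
        (\<exists>C. outcome u a ! (i - 1) = Some C \<and> Suc k \<in> C)"
    then have "Suc k \<in> {c \<in> {1..length u}. parks_in u a c = Some i}"
      using outcome_nth[of i u a] by (auto simp: lenB split: if_splits)
    then show "i = q ! k"
      unfolding mem_block_iff[OF q len] by auto
  qed
qed

text \<open>
  A car stands in the block of its spot, and the outcome shows all blocks of positive capacity,
  so it determines the final state.
\<close>

lemma outcome_eq_iff_park_eq:
  assumes "\<forall>x\<in>set u. 0 < x" and a: "length a = length u" "park u a = map Some q"
    and b: "length b = length u" "park u b = map Some r"
  shows "outcome u a = outcome u b \<longleftrightarrow> park u a = park u b"
proof
  assume eq: "outcome u a = outcome u b"
  have len: "length q = length u" "length r = length u"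
    using a b by (metis length_map length_park)+
  have "q ! k = r ! k" if "k < length u" for k
    using block_index_outcome[OF assms(1) a that] block_index_outcome[OF assms(1) b that] eq
    by simp
  then show "park u a = park u b"
    using a b len by (metis nth_equalityI)
next
  assume "park u a = park u b"
  then show "outcome u a = outcome u b"
    by (simp add: outcome_def parks_in_def)
qed

section \<open>Counting the vectors with a given outcome\<close>

text \<open>
  The starting points of the runs that end at \<open>i - 1\<close> form an interval with right end \<open>i\<close>, where
  \<open>i\<close> itself stands for the empty run. Hence the number of nonempty runs is the length of the
  longest one.
\<close>

lemma card_runs_eq_Max:
  fixes i :: nat
  assumes "1 \<le> i"
  shows "card {p. 1 \<le> p \<and> p < i \<and> (\<forall>t\<in>{p..<i}. Q t)} =
    Max {i - j | j. 1 \<le> j \<and> j \<le> i \<and> (\<forall>t\<in>{j..<i}. Q t)}"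
proof -
  define l where "l = (LEAST j. 1 \<le> j \<and> j \<le> i \<and> (\<forall>t\<in>{j..<i}. Q t))"
  have l: "1 \<le> l \<and> l \<le> i \<and> (\<forall>t\<in>{l..<i}. Q t)"
    unfolding l_def by (rule LeastI[of _ i]) (use assms in auto)
  have least: "l \<le> j" if "1 \<le> j \<and> j \<le> i \<and> (\<forall>t\<in>{j..<i}. Q t)" for j
    unfolding l_def using that by (rule Least_le)
  have runs: "1 \<le> j \<and> j \<le> i \<and> (\<forall>t\<in>{j..<i}. Q t) \<longleftrightarrow> l \<le> j \<and> j \<le> i" for j
    using l least[of j] by auto
  have "1 \<le> p \<and> p < i \<and> (\<forall>t\<in>{p..<i}. Q t) \<longleftrightarrow> l \<le> p \<and> p < i" for p
    using runs[of p] by (cases "p < i") linarith+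
  then have "{p. 1 \<le> p \<and> p < i \<and> (\<forall>t\<in>{p..<i}. Q t)} = {l..<i}"
    by (simp only: atLeastLessThan_def lessThan_def atLeast_def Int_def mem_Collect_eq)
  moreover have "Max {i - j | j. l \<le> j \<and> j \<le> i} = i - l"
    by (rule Max_eqI) (use l in \<open>auto intro: finite_subset[of _ "{..i}"]\<close>)
  ultimately show ?thesis
    unfolding runs by simp
qed

lemma card_lists_nth_mem:
  fixes F :: "nat \<Rightarrow> 'a set"
  shows "card {xs. length xs = n \<and> (\<forall>k<n. xs ! k \<in> F k)} = (\<Prod>k<n. card (F k))"
proof (induction n)
  case 0
  then show ?case by simp
next
  case (Suc n)
  let ?L = "\<lambda>n. {xs. length xs = n \<and> (\<forall>k<n. xs ! k \<in> F k)}"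
  have "?L (Suc n) = (\<lambda>(xs, x). xs @ [x]) ` (?L n \<times> F n)"
  proof (intro set_eqI iffI)
    fix ys assume ys: "ys \<in> ?L (Suc n)"
    then obtain xs x where "ys = xs @ [x]"
      by (cases ys rule: rev_cases) auto
    with ys show "ys \<in> (\<lambda>(xs, x). xs @ [x]) ` (?L n \<times> F n)"
      by (force simp: nth_append split: if_splits)
  qed (auto simp: nth_append less_Suc_eq)
  moreover have "inj_on (\<lambda>(xs, x). xs @ [x]) (?L n \<times> F n)"
    by (auto simp: inj_on_def)
  ultimately have "card (?L (Suc n)) = card (?L n \<times> F n)"
    by (simp add: card_image)
  then show ?case
    using Suc.IH by (simp add: card_cartesian_product)
qed

text \<open>
  The preferences that car \<open>Suc k\<close> may have if the cars park in the spots \<open>q\<close> and the lucky cars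
  are those in \<open>I\<close>.
\<close>

definition choices :: "nat list \<Rightarrow> nat set \<Rightarrow> nat list \<Rightarrow> nat \<Rightarrow> nat set" where
  "choices u I q k =
     {p. 0 < p \<and> first_spot u (map Some (take k q)) p = Some (q ! k) \<and>
         (p = q ! k \<longleftrightarrow> Suc k \<in> I)}"

lemma card_choices:
  assumes pos: "\<forall>x\<in>set u. 0 < x" and a: "length a = length u" "park u a = map Some q"
    and k: "k < length u"
  shows "card (choices u I q k) = (if Suc k \<in> I then 1 else s (outcome u a) (Suc k))"
proof -
  note bounds = spot_bounds[OF pos a k]
  have len: "length q = length u"
    using a by (metis length_map length_park)
  \<comment> \<open>The spot of car \<open>Suc k\<close> is not full when it enters, since the actual run succeeds there.\<close>
  have room: "count_list (take k q) (q ! k) < capacity u (q ! k)"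
  proof -
    have "first_spot u (take k (map Some q)) (a ! k) = map Some q ! k"
      using a(2) k len unfolding park_eq_iff by simp
    then show ?thesis
      using k len by (simp add: first_spot_eq_Some_iff take_map)
  qed
  have mem: "p \<in> choices u I q k \<longleftrightarrow> 0 < p \<and> p \<le> q ! k \<and>
      (\<forall>t\<in>{p..<q ! k}. capacity u t \<le> count_list (take k q) t) \<and>
      (p = q ! k \<longleftrightarrow> Suc k \<in> I)" for p
    using room by (auto simp: choices_def first_spot_eq_Some_iff)
  show ?thesis
  proof (cases "Suc k \<in> I")
    case True
    then have "choices u I q k = {q ! k}"
      using mem bounds by auto
    with True show ?thesis by simp
  next
    case False
    have full: "(\<forall>t\<in>{p..<q ! k}. capacity u t \<le> count_list (take k q) t) \<longleftrightarrow>
        (\<forall>t\<in>{p..<q ! k}. block_max (outcome u a) t < Some (Suc k))" if "1 \<le> p" for p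
      using that bounds full_iff_block_max_less[OF a, of _ k] by auto
    have "p \<in> choices u I q k \<longleftrightarrow> 1 \<le> p \<and> p < q ! k \<and>
        (\<forall>t\<in>{p..<q ! k}. block_max (outcome u a) t < Some (Suc k))" for p
      using mem[of p] False full[of p] by (cases "1 \<le> p") linarith+
    then have "choices u I q k = {p. 1 \<le> p \<and> p < q ! k \<and>
        (\<forall>t\<in>{p..<q ! k}. block_max (outcome u a) t < Some (Suc k))}"
      by blast
    then have "card (choices u I q k) = s (outcome u a) (Suc k)"
      using card_runs_eq_Max[OF bounds(1)] block_index_outcome[OF pos a k]
      by (simp add: s_def Let_def)
    with False show ?thesis by simp
  qed
qed

lemma Lucky_eq_iff:
  assumes "length a = length u" and "park u a = map Some q" and "I \<subseteq> {1..length u}"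
  shows "Lucky u a = I \<longleftrightarrow> (\<forall>k<length u. a ! k = q ! k \<longleftrightarrow> Suc k \<in> I)"
proof -
  have len: "length q = length u"
    using assms by (metis length_map length_park)
  have *: "Suc k \<in> Lucky u a \<longleftrightarrow> a ! k = q ! k" if "k < length u" for k
    using that len parks_in_Suc[OF assms(2), of k] by (auto simp: Lucky_def)
  have sub: "Lucky u a \<subseteq> {1..length u}"
    by (auto simp: Lucky_def)
  have "{1..length u} = Suc ` {..<length u}"
    by (simp add: image_Suc_lessThan)
  then have "Lucky u a = I \<longleftrightarrow> (\<forall>k<length u. Suc k \<in> Lucky u a \<longleftrightarrow> Suc k \<in> I)"
    using sub assms(3) by auto
  then show ?thesis
    using * by auto
qed

lemma fiber_eq:
  assumes pos: "\<forall>x\<in>set u. 0 < x" and a: "length a = length u" "park u a = map Some q"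
    and I: "I \<subseteq> {1..length u}"
  shows "{b \<in> LuckyPF u I. outcome u b = outcome u a} =
    {b. length b = length u \<and> (\<forall>k<length u. b ! k \<in> choices u I q k)}"
proof (rule set_eqI)
  fix b
  have len: "length q = length u"
    using a by (metis length_map length_park)
  have "b \<in> LuckyPF u I \<and> outcome u b = outcome u a \<longleftrightarrow>
      length b = length u \<and> (\<forall>p\<in>set b. 0 < p) \<and> park u b = map Some q \<and> Lucky u b = I"
    unfolding LuckyPF_def mem_Collect_eq mem_PF_iff
    using outcome_eq_iff_park_eq[OF pos _ _ a] a(2) by auto
  also have "\<dots> \<longleftrightarrow> length b = length u \<and> (\<forall>p\<in>set b. 0 < p) \<and> park u b = map Some q \<and>
      (\<forall>k<length u. b ! k = q ! k \<longleftrightarrow> Suc k \<in> I)"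
    using Lucky_eq_iff[OF _ _ I] by blast
  also have "\<dots> \<longleftrightarrow> length b = length u \<and> (\<forall>k<length u. b ! k \<in> choices u I q k)"
    using len by (auto simp: park_eq_iff choices_def all_set_conv_all_nth take_map)
  finally show "b \<in> {b \<in> LuckyPF u I. outcome u b = outcome u a} \<longleftrightarrow>
      b \<in> {b. length b = length u \<and> (\<forall>k<length u. b ! k \<in> choices u I q k)}"
    by simp
qed

lemma card_fiber:
  assumes pos: "\<forall>x\<in>set u. 0 < x" and a: "a \<in> PF u" and I: "I \<subseteq> {1..length u}"
  shows "card {b \<in> LuckyPF u I. outcome u b = outcome u a} =
    (\<Prod>b\<in>{1..length u} - I. s (outcome u a) b)"
proof -
  obtain q where q: "length a = length u" "park u a = map Some q"
    using a by (auto simp: mem_PF_iff)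
  have "card {b \<in> LuckyPF u I. outcome u b = outcome u a} =
      (\<Prod>k<length u. card (choices u I q k))"
    unfolding fiber_eq[OF pos q I] by (rule card_lists_nth_mem)
  also have "\<dots> = (\<Prod>k<length u. if Suc k \<in> I then 1 else s (outcome u a) (Suc k))"
    using card_choices[OF pos q] by (intro prod.cong) auto
  also have "\<dots> = (\<Prod>b\<in>Suc ` {..<length u}. if b \<in> I then 1 else s (outcome u a) b)"
    by (simp add: prod.reindex)
  also have "\<dots> = (\<Prod>b\<in>{1..length u}. if b \<in> I then 1 else s (outcome u a) b)"
    by (simp add: image_Suc_lessThan)
  also have "\<dots> = (\<Prod>b\<in>{1..length u} - I. s (outcome u a) b)"
    by (rule prod.mono_neutral_cong_right) auto
  finally show ?thesis .
qed

text \<open>No car prefers a spot behind its own, and no car parks behind the last spot.\<close>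

lemma finite_PF:
  assumes pos: "\<forall>x\<in>set u. 0 < x"
  shows "finite (PF u)"
proof (rule finite_subset)
  show "PF u \<subseteq> {a. set a \<subseteq> {..Max (set u)} \<and> length a = length u}"
  proof
    fix a assume "a \<in> PF u"
    then obtain q where q: "length a = length u" "park u a = map Some q"
      by (auto simp: mem_PF_iff)
    have "a ! k \<le> Max (set u)" if k: "k < length u" for k
    proof -
      have "first_spot u (take k (map Some q)) (a ! k) = Some (q ! k)"
        using q(2) k q(1) unfolding park_eq_iff by simp
      then have "a ! k \<le> q ! k"
        by (simp add: first_spot_eq_Some_iff)
      with spot_bounds(2)[OF pos q k] show ?thesis by simp
    qed
    with q(1) show "a \<in> {a. set a \<subseteq> {..Max (set u)} \<and> length a = length u}"
      by (auto simp: in_set_conv_nth)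
  qed
qed (simp add: finite_lists_length_eq)

theorem theorem5p7:
  fixes u :: "nat list" and I :: "nat set"
  assumes "u \<noteq> []" and "sorted u" and "\<forall>x\<in>set u. 0 < x"
    and "lucky_set u I"
  shows "card (LuckyPF u I) = (\<Sum>B\<in>outcomes u I. \<Prod>b\<in>{1..length u} - I. s B b)"
proof -
  have I: "I \<subseteq> {1..length u}"
    using assms(4) by (simp add: lucky_set_def)
  have "finite (LuckyPF u I)"
    using finite_PF[OF assms(3)] by (simp add: LuckyPF_def)
  then have "card (LuckyPF u I) =
      (\<Sum>B\<in>outcomes u I. card {b \<in> LuckyPF u I. outcome u b = B})"
    unfolding outcomes_def card_eq_sum by (rule sum.image_gen)
  also have "\<dots> = (\<Sum>B\<in>outcomes u I. \<Prod>b\<in>{1..length u} - I. s B b)"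
  proof (rule sum.cong[OF refl])
    fix B assume "B \<in> outcomes u I"
    then obtain a where "a \<in> PF u" "B = outcome u a"
      by (auto simp: outcomes_def LuckyPF_def)
    then show "card {b \<in> LuckyPF u I. outcome u b = B} = (\<Prod>b\<in>{1..length u} - I. s B b)"
      using card_fiber[OF assms(3) _ I] by simp
  qed
  finally show ?thesis .
qed

end
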